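(* Let $\mathcal{M}_i$ and $\mathcal{M}_j$ be two models whose classes of loss functions $\mathcal{L}_i=\{l(\cdot,\boldsymbol\theta_i):\boldsymbol\theta_i\in\mathcal{H}_i\}$ and $\mathcal{L}_j=\{l(\cdot,\boldsymbol\theta_j):\boldsymbol\theta_j\in\mathcal{H}_j\}$ are Glivenko–Cantelli classes, and let $\mathcal{M}_i$ be nested in $\mathcal{M}_j$, so that $R(\boldsymbol\theta_i^* )\ge R(\boldsymbol\theta_j^* )$. Let $\gamma_{i,j}(n,\delta,S_n)$ be a function of order $o(1)$ for which there is a positive integer $N$ such that for every $n\ge N$ and every $0<\delta\le1$, $$\mathbb{P}\Big\{\big|R_{emp}(S_n,\hat{\boldsymbol\theta}_i)-R_{emp}(S_n,\hat{\boldsymbol\theta}_j)-R(\boldsymbol\theta_i^* )+R(\boldsymbol\theta_j^* )\big|\le\gamma_{i,j}(n,\delta,S_n)\Big\}\ge 1-\delta .$$ Then: (State 1) If $R(\boldsymbol\theta_i^* )>R(\boldsymbol\theta_j^* )$, then for every $0<\delta\le1$ there is a positive integer $N_1$ such that for every $n\ge N_1$, with probability at least $1-\delta$, $$R_{emp}(S_n,\hat{\boldsymbol\theta}_i)-R_{emp}(S_n,\hat{\boldsymbol\theta}_j)\ge\gamma_{i,j}(n,\delta,S_n).$$ (State 2) If $R(\boldsymbol\theta_i^* )=R(\boldsymbol\theta_j^* )$, then there is a positive integer $N_2$ such that for every $n\ge N_2$ and every $0<\delta\le1$, with probability at least $1-\delta$, $$R_{emp}(S_n,\hat{\boldsymb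ol\theta}_i)-R_{emp}(S_n,\hat{\boldsymbol\theta}_j)\le\gamma_{i,j}(n,\delta,S_n).$$
   Context: Setting: $S_n=(\mathbf{z}_1,\dots,\mathbf{z}_n)$ consists of $n$ i.i.d. copies of a random element $\mathbf{Z}$ with unknown distribution $\mathcal{P}$ (on $\mathcal{X}\subset\mathbb{R}^p$ with $\mathbf{z}=\mathbf{x}$ in the unsupervised case, or on $\mathcal{X}\times\mathcal{Y}$, $\mathcal{Y}\subset\mathbb{R}^q$, with $\mathbf{z}=(\mathbf{x},\mathbf{y})$ in the supervised case). A model $\mathcal{M}_k=\{f_{\boldsymbol\theta_k}:\boldsymbol\theta_k\in\mathcal{H}_k\}$ is a set of functions (probability densities or conditional densities / predictors) with parameter space $\mathcal{H}_k$. The nonnegative loss $l(\mathbf{z},\boldsymbol\theta)$ stands for $l(f_{\boldsymbol\theta}(\mathbf{x}))$ or $l(f_{\boldsymbol\theta}(\mathbf{x}),\mathbf{y})$, so it depends on $\boldsymbol\theta$ only through $f_{\boldsymbol\theta}$. The risk is $R(\boldsymbol\theta)=\mathbb{E}\{l(\mathbf{Z},\boldsymbol\theta)\}$ and the empirical risk is $R_{emp}(S_n,\boldsymbol\theta)=\frac1n\sum_{i=1}^n l(\mathbf{z}_i,\boldsymbol\theta)$. For each model, $\boldsymbol\theta_k^*\in\arg\min_{\boldsymbol\theta_k\in\mathcal{H}_k}R(\boldsymbol\theta_k)$ and $\hat{\boldsymbol\theta}_k\in\arg\min_{\boldsymbol\theta_k\in\mathcal{H}_k}R_{emp}(S_n,\boldsymbol\theta_k)$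 (minimizers are assumed to exist). Glivenko–Cantelli: a class $\mathcal{F}$ is Glivenko–Cantelli for the distribution of $\mathbf{Z}$ if for every $\varepsilon>0$, $\lim_{n\to\infty}\mathbb{P}\{\sup_{f\in\mathcal{F}}|\frac1n\sum_{i=1}^n f(\mathbf{z}_i)-\mathbb{E}\{f(\mathbf{Z})\}|>\varepsilon\}=0$. Nested: $\mathcal{M}_i$ is nested in $\mathcal{M}_j$ if for all $\boldsymbol\theta_i\in\mathcal{H}_i$ there is $\boldsymbol\theta_j\in\mathcal{H}_j$ (not necessarily equal to $\boldsymbol\theta_i$) with $f_{\boldsymbol\theta_i}=f_{\boldsymbol\theta_j}$ (pointwise equality everywhere). Order $o(1)$: for every fixed $\delta\in(0,1]$ and every $\varepsilon>0$ there is $n_0$ such that $\gamma_{i,j}(n,\delta,S_n)\le\varepsilon$ for all $n\ge n_0$. Although $S_n$ appears as an argument in the notation, $\gamma_{i,j}$ is a deterministic function. *)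

theory Defs
  imports "HOL-Probability.Probability"
begin

text \<open>An observation \<open>z\<close> has an input part \<open>inp z\<close> and a target part \<open>tgt z\<close>, and the loss compares
  the value of a model function at the input with the target.  The supervised setting is
  \<open>inp = fst\<close>, \<open>tgt = snd\<close>; the unsupervised one is \<open>inp = id\<close> with a trivial target
  (see the two lemmas below).  Conditional densities are covered by letting the values of the model
  functions be functions themselves.\<close>

definition model_loss ::
    "('z \<Rightarrow> 'x) \<Rightarrow> ('z \<Rightarrow> 'y) \<Rightarrow> ('v \<Rightarrow> 'y \<Rightarrow> real) \<Rightarrow> ('p \<Rightarrow> 'x \<Rightarrow> 'v) \<Rightarrow> 'z \<Rightarrow> 'p \<Rightarrow> real" where
  "model_loss inp tgt l f z \<theta> = l (f \<theta> (inp z)) (tgt z)"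

lemma model_loss_supervised: "model_loss fst snd l f (x, y) \<theta> = l (f \<theta> x) y"
  by (simp add: model_loss_def)

lemma model_loss_unsupervised: "model_loss id (\<lambda>_. ()) (\<lambda>v _. l v) f x \<theta> = l (f \<theta> x)"
  by (simp add: model_loss_def)

definition iid_sequence :: "'o measure \<Rightarrow> 'z measure \<Rightarrow> (nat \<Rightarrow> 'o \<Rightarrow> 'z) \<Rightarrow> bool" where
  "iid_sequence M P Z \<longleftrightarrow>
     prob_space.indep_vars M (\<lambda>_. P) Z UNIV \<and> (\<forall>i. distr M P (Z i) = P)"

definition sample :: "(nat \<Rightarrow> 'o \<Rightarrow> 'z) \<Rightarrow> nat \<Rightarrow> 'o \<Rightarrow> 'z list" where
  "sample Z n \<omega> = map (\<lambda>i. Z i \<omega>) [0..<n]"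

definition emp_mean :: "'z list \<Rightarrow> ('z \<Rightarrow> real) \<Rightarrow> real" where
  "emp_mean S f = (\<Sum>z\<leftarrow>S. f z) / real (length S)"

definition emp_risk :: "('z \<Rightarrow> 'p \<Rightarrow> real) \<Rightarrow> 'z list \<Rightarrow> 'p \<Rightarrow> real" where
  "emp_risk loss S \<theta> = emp_mean S (\<lambda>z. loss z \<theta>)"

definition risk :: "'z measure \<Rightarrow> ('z \<Rightarrow> 'p \<Rightarrow> real) \<Rightarrow> 'p \<Rightarrow> real" where
  "risk P loss \<theta> = (\<integral>z. loss z \<theta> \<partial>P)"

definition loss_class :: "('z \<Rightarrow> 'p \<Rightarrow> real) \<Rightarrow> 'p set \<Rightarrow> ('z \<Rightarrow> real) set" where
  "loss_class loss H = (\<lambda>\<theta> z. loss z \<theta>) ` H"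

text \<open>Integrability makes the expectations meaningful (the Bochner integral of a non-integrable
  function is \<open>0\<close> by convention).  The supremum over a possibly uncountable class is taken in the
  extended reals and need not be measurable, so the probability is an outer one; it is the ordinary
  probability whenever the event is measurable.\<close>

definition glivenko_cantelli ::
    "'o measure \<Rightarrow> 'z measure \<Rightarrow> (nat \<Rightarrow> 'o \<Rightarrow> 'z) \<Rightarrow> ('z \<Rightarrow> real) set \<Rightarrow> bool" where
  "glivenko_cantelli M P Z F \<longleftrightarrow>
     (\<forall>f\<in>F. integrable P f) \<and>
     (\<forall>\<epsilon>>0. (\<lambda>n. outer_measure_of M
        {\<omega> \<in> space M. (SUP f\<in>F. ereal \<bar>emp_mean (sample Z n \<omega>) f - (\<integral>z. f z \<partial>P)\<bar>) > ereal \<epsilon>})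
        \<longlonglongrightarrow> 0)"

definition nested_in ::
    "'x set \<Rightarrow> ('a \<Rightarrow> 'x \<Rightarrow> 'v) \<Rightarrow> 'a set \<Rightarrow> ('b \<Rightarrow> 'x \<Rightarrow> 'v) \<Rightarrow> 'b set \<Rightarrow> bool" where
  "nested_in X fi Hi fj Hj \<longleftrightarrow> (\<forall>\<theta>i\<in>Hi. \<exists>\<theta>j\<in>Hj. \<forall>x\<in>X. fi \<theta>i x = fj \<theta>j x)"

definition order_o1 :: "(nat \<Rightarrow> real \<Rightarrow> real) \<Rightarrow> bool" where
  "order_o1 \<gamma> \<longleftrightarrow>
     (\<forall>\<delta>. 0 < \<delta> \<and> \<delta> \<le> 1 \<longrightarrow> (\<forall>\<epsilon>>0. \<exists>n0. \<forall>n\<ge>n0. \<gamma> n \<delta> \<le> \<epsilon>))"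

text \<open>``\<open>Q\<close> holds with probability at least \<open>p\<close>''.  Minimal empirical risks are infima over possibly
  uncountable sets, so \<open>Q\<close> need not describe a measurable event; for measurable events this is the
  ordinary notion, by the lemma below.\<close>

definition with_prob_at_least :: "'o measure \<Rightarrow> real \<Rightarrow> ('o \<Rightarrow> bool) \<Rightarrow> bool" where
  "with_prob_at_least M p Q \<longleftrightarrow> (\<exists>E\<in>sets M. (\<forall>\<omega>\<in>E. Q \<omega>) \<and> p \<le> measure M E)"

lemma with_prob_at_least_measurable:
  assumes "prob_space M" and "{\<omega> \<in> space M. Q \<omega>} \<in> sets M"
  shows "with_prob_at_least M p Q \<longleftrightarrow> p \<le> measure M {\<omega> \<in> space M. Q \<omega>}"
proof
  interpret prob_space M by fact
  assume "with_prob_at_least M p Q"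
  then obtain E where E: "E \<in> sets M" "\<forall>\<omega>\<in>E. Q \<omega>" "p \<le> measure M E"
    unfolding with_prob_at_least_def by blast
  have "E \<subseteq> {\<omega> \<in> space M. Q \<omega>}"
    using E(2) sets.sets_into_space[OF E(1)] by blast
  then have "measure M E \<le> measure M {\<omega> \<in> space M. Q \<omega>}"
    using assms(2) by (rule finite_measure_mono)
  with E(3) show "p \<le> measure M {\<omega> \<in> space M. Q \<omega>}" by linarith
next
  assume "p \<le> measure M {\<omega> \<in> space M. Q \<omega>}"
  then show "with_prob_at_least M p Q"
    unfolding with_prob_at_least_def using assms(2)
    by (intro bexI[of _ "{\<omega> \<in> space M. Q \<omega>}"]) simp_all
qed

end

theory Submission
  imports Defs
begin

text \<open>On the event of probability at least \<open>1 - \<delta>\<close> given by the hypothesis, the difference of the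
  empirical risks lies within \<open>\<gamma>\<close> of the gap \<open>\<Delta>\<close> between the optimal risks.  If \<open>\<Delta> > 0\<close>, then
  eventually \<open>\<gamma> \<le> \<Delta> / 2\<close>, so the difference is at least \<open>\<Delta> - \<gamma> \<ge> \<gamma>\<close>; if \<open>\<Delta> = 0\<close>, it is
  at most \<open>\<gamma>\<close>.  Both conclusions thus hold on that same event.\<close>

text \<open>The measurable event that witnesses \<open>Q\<close> also witnesses \<open>Q'\<close>.
  This moves the event of the hypothesis over to each conclusion.\<close>

lemma with_prob_at_least_mono:
  assumes "with_prob_at_least M p Q" and "\<And>\<omega>. Q \<omega> \<Longrightarrow> Q' \<omega>"
  shows "with_prob_at_least M p Q'"
  using assms unfolding with_prob_at_least_def by blast

text \<open>The function of \<open>\<theta>i\<close> also occurs in the larger model, under some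
  parameter of \<open>Hj\<close>. Equal functions have equal losses and hence equal risks, so the
  minimum over \<open>Hj\<close> cannot exceed the risk of \<open>\<theta>i\<close>.\<close>

lemma risk_le_of_nested_in:
  assumes "nested_in X fi Hi fj Hj" and "inp ` space P \<subseteq> X"
    and \<theta>i: "is_arg_min (risk P (model_loss inp tgt l fi)) (\<lambda>\<theta>. \<theta> \<in> Hi) \<theta>i"
    and \<theta>j: "is_arg_min (risk P (model_loss inp tgt l fj)) (\<lambda>\<theta>. \<theta> \<in> Hj) \<theta>j"
  shows "risk P (model_loss inp tgt l fj) \<theta>j \<le> risk P (model_loss inp tgt l fi) \<theta>i"
proof -
  from \<theta>i have "\<theta>i \<in> Hi"
    by (simp add: is_arg_min_def)
  with assms(1) obtain \<theta> where \<theta>: "\<theta> \<in> Hj" "\<forall>x\<in>X. fi \<theta>i x = fj \<theta> x"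
    unfolding nested_in_def by blast
  have "risk P (model_loss inp tgt l fj) \<theta>j \<le> risk P (model_loss inp tgt l fj) \<theta>"
    using \<theta>j \<theta>(1) by (simp add: is_arg_min_linorder)
  \<comment> \<open>The two functions agree only on \<open>X\<close>; since \<open>inp\<close> maps
    \<open>space P\<close> into \<open>X\<close>, the integrands agree on all of
    \<open>space P\<close>.\<close>
  also have "\<dots> = risk P (model_loss inp tgt l fi) \<theta>i"
    unfolding risk_def model_loss_def using \<theta>(2) assms(2)
    by (intro Bochner_Integration.integral_cong) auto
  finally show ?thesis .
qed

theorem theorem2:
  fixes M :: "'o measure"
    and D :: "'z::euclidean_space set" and P :: "'z measure" and Z :: "nat \<Rightarrow> 'o \<Rightarrow> 'z"
    and X :: "'x::euclidean_space set" and inp :: "'z \<Rightarrow> 'x" and tgt :: "'z \<Rightarrow> 'y"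
    and l :: "'v \<Rightarrow> 'y \<Rightarrow> real"
    and Hi :: "'a set" and fi :: "'a \<Rightarrow> 'x \<Rightarrow> 'v"
    and Hj :: "'b set" and fj :: "'b \<Rightarrow> 'x \<Rightarrow> 'v"
    and lossi :: "'z \<Rightarrow> 'a \<Rightarrow> real" and lossj :: "'z \<Rightarrow> 'b \<Rightarrow> real"
    and \<theta>i_star :: 'a and \<theta>j_star :: 'b
    and \<theta>i_hat :: "'z list \<Rightarrow> 'a" and \<theta>j_hat :: "'z list \<Rightarrow> 'b"
    and \<gamma> :: "nat \<Rightarrow> real \<Rightarrow> real"
  defines "lossi \<equiv> model_loss inp tgt l fi" and "lossj \<equiv> model_loss inp tgt l fj"
  assumes "prob_space M"
    and "prob_space P" and "sets P = sets (restrict_space borel D)"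
    and "iid_sequence M P Z"
    and "inp ` D \<subseteq> X"
    and "\<forall>z\<in>D. \<forall>\<theta>\<in>Hi. 0 \<le> lossi z \<theta>" and "\<forall>z\<in>D. \<forall>\<theta>\<in>Hj. 0 \<le> lossj z \<theta>"
    and "is_arg_min (risk P lossi) (\<lambda>\<theta>. \<theta> \<in> Hi) \<theta>i_star"
    and "is_arg_min (risk P lossj) (\<lambda>\<theta>. \<theta> \<in> Hj) \<theta>j_star"
    and "\<forall>n\<ge>1. \<forall>\<omega>\<in>space M. is_arg_min (emp_risk lossi (sample Z n \<omega>)) (\<lambda>\<theta>. \<theta> \<in> Hi)
           (\<theta>i_hat (sample Z n \<omega>))"
    and "\<forall>n\<ge>1. \<forall>\<omega>\<in>space M. is_arg_min (emp_risk lossj (sample Z n \<omega>)) (\<lambda>\<theta>. \<theta> \<in> Hj)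
           (\<theta>j_hat (sample Z n \<omega>))"
    and "glivenko_cantelli M P Z (loss_class lossi Hi)"
    and "glivenko_cantelli M P Z (loss_class lossj Hj)"
    and "nested_in X fi Hi fj Hj"
    and "order_o1 \<gamma>"
    and "\<exists>N>0. \<forall>n\<ge>N. \<forall>\<delta>. 0 < \<delta> \<and> \<delta> \<le> 1 \<longrightarrow>
           with_prob_at_least M (1 - \<delta>) (\<lambda>\<omega>.
             \<bar>emp_risk lossi (sample Z n \<omega>) (\<theta>i_hat (sample Z n \<omega>))
              - emp_risk lossj (sample Z n \<omega>) (\<theta>j_hat (sample Z n \<omega>))
              - risk P lossi \<theta>i_star + risk P lossj \<theta>j_star\<bar> \<le> \<gamma> n \<delta>)"
  shows "risk P lossi \<theta>i_star \<ge> risk P lossj \<theta>j_star \<and>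
    (risk P lossi \<theta>i_star > risk P lossj \<theta>j_star \<longrightarrow>
      (\<forall>\<delta>. 0 < \<delta> \<and> \<delta> \<le> 1 \<longrightarrow> (\<exists>N1>0. \<forall>n\<ge>N1.
         with_prob_at_least M (1 - \<delta>) (\<lambda>\<omega>.
           emp_risk lossi (sample Z n \<omega>) (\<theta>i_hat (sample Z n \<omega>))
           - emp_risk lossj (sample Z n \<omega>) (\<theta>j_hat (sample Z n \<omega>)) \<ge> \<gamma> n \<delta>)))) \<and>
    (risk P lossi \<theta>i_star = risk P lossj \<theta>j_star \<longrightarrow>
      (\<exists>N2>0. \<forall>n\<ge>N2. \<forall>\<delta>. 0 < \<delta> \<and> \<delta> \<le> 1 \<longrightarrow>
         with_prob_at_least M (1 - \<delta>) (\<lambda>\<omega>.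
           emp_risk lossi (sample Z n \<omega>) (\<theta>i_hat (sample Z n \<omega>))
           - emp_risk lossj (sample Z n \<omega>) (\<theta>j_hat (sample Z n \<omega>)) \<le> \<gamma> n \<delta>)))"
proof (intro conjI impI allI)
  \<comment> \<open>Equal sigma-algebras have the same underlying space, and that of
    \<open>borel\<close> restricted to \<open>D\<close> is \<open>D\<close>.\<close>
  have "space P = D"
    using sets_eq_imp_space_eq[OF assms(5)] by (simp add: space_restrict_space)
  with assms(7) have "inp ` space P \<subseteq> X"
    by simp
  from risk_le_of_nested_in[OF assms(16) this assms(10)[unfolded lossi_def]
      assms(11)[unfolded lossj_def]]
  show "risk P lossj \<theta>j_star \<le> risk P lossi \<theta>i_star"
    unfolding lossi_def lossj_def .
next
  let ?\<Delta> = "risk P lossi \<theta>i_star - risk P lossj \<theta>j_star"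
  fix \<delta> :: real
  assume gap: "risk P lossj \<theta>j_star < risk P lossi \<theta>i_star" and \<delta>: "0 < \<delta> \<and> \<delta> \<le> 1"
  \<comment> \<open>Half the gap serves as \<open>\<epsilon>\<close> in \<open>order_o1\<close>. The
    resulting \<open>n0\<close> depends on \<open>\<delta>\<close>, which is why \<open>N1\<close>
    is chosen after \<open>\<delta>\<close>.\<close>
  from gap have "0 < ?\<Delta> / 2"
    by simp
  with assms(17) \<delta> obtain n0 where n0: "\<And>n. n \<ge> n0 \<Longrightarrow> \<gamma> n \<delta> \<le> ?\<Delta> / 2"
    unfolding order_o1_def by meson
  from assms(18) obtain N where N: "N > 0" "\<forall>n\<ge>N. \<forall>\<delta>. 0 < \<delta> \<and> \<delta> \<le> 1 \<longrightarrow>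
      with_prob_at_least M (1 - \<delta>) (\<lambda>\<omega>.
        \<bar>emp_risk lossi (sample Z n \<omega>) (\<theta>i_hat (sample Z n \<omega>))
         - emp_risk lossj (sample Z n \<omega>) (\<theta>j_hat (sample Z n \<omega>))
         - risk P lossi \<theta>i_star + risk P lossj \<theta>j_star\<bar> \<le> \<gamma> n \<delta>)"
    by blast
  show "\<exists>N1>0. \<forall>n\<ge>N1. with_prob_at_least M (1 - \<delta>) (\<lambda>\<omega>.
      emp_risk lossi (sample Z n \<omega>) (\<theta>i_hat (sample Z n \<omega>))
      - emp_risk lossj (sample Z n \<omega>) (\<theta>j_hat (sample Z n \<omega>)) \<ge> \<gamma> n \<delta>)"
  \<comment> \<open>Beyond \<open>N\<close> the probability bound is available, beyond
    \<open>n0\<close> the bound on \<open>\<gamma>\<close>. Positivity comes from \<open>N\<close>,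
    as \<open>n0\<close> may be 0.\<close>
  proof (intro exI[of _ "max N n0"] conjI allI impI)
    show "max N n0 > 0"
      using N(1) by simp
  next
    fix n
    assume "n \<ge> max N n0"
    then have n: "n \<ge> N" "\<gamma> n \<delta> \<le> ?\<Delta> / 2"
      using n0 by auto
    show "with_prob_at_least M (1 - \<delta>) (\<lambda>\<omega>.
        emp_risk lossi (sample Z n \<omega>) (\<theta>i_hat (sample Z n \<omega>))
        - emp_risk lossj (sample Z n \<omega>) (\<theta>j_hat (sample Z n \<omega>)) \<ge> \<gamma> n \<delta>)"
    proof (rule with_prob_at_least_mono[OF N(2)[rule_format, OF n(1) \<delta>]])
      fix \<omega>
      let ?d = "emp_risk lossi (sample Z n \<omega>) (\<theta>i_hat (sample Z n \<omega>))
        - emp_risk lossj (sample Z n \<omega>) (\<theta>j_hat (sample Z n \<omega>))"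
      assume "\<bar>?d - risk P lossi \<theta>i_star + risk P lossj \<theta>j_star\<bar> \<le> \<gamma> n \<delta>"
      \<comment> \<open>The lower half of the absolute value bound gives
        \<open>?d \<ge> ?\<Delta> - \<gamma> n \<delta>\<close>, and
        \<open>?\<Delta> \<ge> 2 * \<gamma> n \<delta>\<close>.\<close>
      from abs_le_D2[OF this] n(2) show "\<gamma> n \<delta> \<le> ?d"
        by (simp add: field_simps)
    qed
  qed
next
  assume eq: "risk P lossi \<theta>i_star = risk P lossj \<theta>j_star"
  from assms(18) obtain N where N: "N > 0" "\<forall>n\<ge>N. \<forall>\<delta>. 0 < \<delta> \<and> \<delta> \<le> 1 \<longrightarrow>
      with_prob_at_least M (1 - \<delta>) (\<lambda>\<omega>.
        \<bar>emp_risk lossi (sample Z n \<omega>) (\<theta>i_hat (sample Z n \<omega>))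
         - emp_risk lossj (sample Z n \<omega>) (\<theta>j_hat (sample Z n \<omega>))
         - risk P lossi \<theta>i_star + risk P lossj \<theta>j_star\<bar> \<le> \<gamma> n \<delta>)"
    by blast
  show "\<exists>N2>0. \<forall>n\<ge>N2. \<forall>\<delta>. 0 < \<delta> \<and> \<delta> \<le> 1 \<longrightarrow>
      with_prob_at_least M (1 - \<delta>) (\<lambda>\<omega>.
        emp_risk lossi (sample Z n \<omega>) (\<theta>i_hat (sample Z n \<omega>))
        - emp_risk lossj (sample Z n \<omega>) (\<theta>j_hat (sample Z n \<omega>)) \<le> \<gamma> n \<delta>)"
  \<comment> \<open>The \<open>N\<close> of the hypothesis is uniform in \<open>\<delta>\<close> and
    works unchanged, so \<open>N2\<close> can be chosen before \<open>\<delta>\<close>.\<close>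
  proof (intro exI[of _ N] conjI allI impI)
    fix n :: nat and \<delta> :: real
    assume "n \<ge> N" and "0 < \<delta> \<and> \<delta> \<le> 1"
    \<comment> \<open>By \<open>eq\<close> the two risks cancel inside the absolute value, and a
      real number is at most its absolute value.\<close>
    then show "with_prob_at_least M (1 - \<delta>) (\<lambda>\<omega>.
        emp_risk lossi (sample Z n \<omega>) (\<theta>i_hat (sample Z n \<omega>))
        - emp_risk lossj (sample Z n \<omega>) (\<theta>j_hat (sample Z n \<omega>)) \<le> \<gamma> n \<delta>)"
      by (rule with_prob_at_least_mono[OF N(2)[rule_format]]) (use eq in linarith)
  qed (rule N(1))
qed

end
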